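(* No bribeproof $\lambda$-linear mechanism for makespan minimization on three agents with two-values domains can approximate the makespan within a factor smaller than $\frac{2}{\sqrt3}\approx 1.1547$. That is: for every $\alpha<\frac{2}{\sqrt3}$ there are a finite list of job sizes and reals $0<L<H$ such that, for three agents with $\Theta=\{L,H\}^3$, there is no $\lambda\in[0,1]$ and no algorithm $A$ that approximates the makespan within a factor $\alpha$ for which the $\lambda$-linear mechanism with algorithm $A$ is bribeproof.
   Context: Scheduling selfish related machines: there are agents (machines) $N=\{1,\dots,n\}$ and finitely many indivisible jobs, each with a positive size. A feasible solution assigns each job to one machine; the allocation is the vector $a\in\mathbb{R}_+^n$ where $a_i$ is the total size of the jobs assigned to machine $i$, and $\mathcal{A}$ is the set of all such vectors. Agent $i$ has private type $\theta_i\in\Theta_i$ (cost per unit of work) and cost $a_i\theta_i$; the makespan of $a$ for $\theta$ is $\max_{i}a_i\theta_i$. $\Theta=\Theta_1\times\cdots\times\Theta_n$. An algorithm $A:\Theta\to\mathcal{A}$ approximates the makespan within a factor $\alpha$ if for every $\theta\in\Theta$ the makespan of $A(\theta)$ for $\theta$ is at most $\alpha$ times the minimum makespan over $\mathcal{A}$ for $\theta$. A mechanism is a pair $(A,p)$ with $A:\Theta\to\mathcal{A}$ and payments $p:\Theta\to\mathbb{R}^n$. The $\lambda$-linear mechanism with algorithm $A$ has $p_i(\theta)=A_i(\theta)(\lambda L+(1-\lambda)H)+f_i$ for all $i,\theta$, with arbitrary real constants $f_i$. $(A,p)$ is bribeproof if for all $\theta\in\Theta$, all $i,j\in N$ and all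 $\hat\theta_i\in\Theta_i$, with $\hat\theta$ denoting $\theta$ with its $i$-th entry replaced by $\hat\theta_i$: if $i\neq j$, $p_i(\theta)-A_i(\theta)\theta_i+p_j(\theta)-A_j(\theta)\theta_j\ge p_i(\hat\theta)-A_i(\hat\theta)\theta_i+p_j(\hat\theta)-A_j(\hat\theta)\theta_j$; and, for $i=j$, $p_i(\theta)-A_i(\theta)\theta_i\ge p_i(\hat\theta)-A_i(\hat\theta)\theta_i$. *)

theory Defs
  imports "HOL-Analysis.Analysis"
begin

text \<open>
  Agents are the elements of a finite type \<open>'n\<close>; jobs are the positions of the list \<open>w\<close> of
  job sizes. A solution \<open>s\<close> maps each job to its machine; its values outside \<open>{..<length w}\<close>
  are irrelevant.
\<close>

definition load :: "real list \<Rightarrow> (nat \<Rightarrow> 'n::finite) \<Rightarrow> 'n \<Rightarrow> real" where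
  "load w s i = (\<Sum>k | k < length w \<and> s k = i. w ! k)"

definition allocations :: "real list \<Rightarrow> ('n::finite \<Rightarrow> real) set" where
  "allocations w = range (load w)"

definition makespan :: "('n::finite \<Rightarrow> real) \<Rightarrow> ('n \<Rightarrow> real) \<Rightarrow> real" where
  "makespan \<theta> a = Max (range (\<lambda>i. a i * \<theta> i))"

definition min_makespan :: "real list \<Rightarrow> ('n::finite \<Rightarrow> real) \<Rightarrow> real" where
  "min_makespan w \<theta> = Min (makespan \<theta> ` allocations w)"

text \<open>The set over which \<open>Min\<close> is taken in \<^const>\<open>min_makespan\<close> is finite and nonempty.\<close>

lemma finite_allocations: "finite (allocations w :: ('n::finite \<Rightarrow> real) set)"
proof -
  have "load w s \<in> load w ` ({..<length w} \<rightarrow>\<^sub>E UNIV)" for s :: "nat \<Rightarrow> 'n"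
  proof
    show "load w s = load w (restrict s {..<length w})"
      unfolding load_def by (intro ext sum.cong) auto
  qed auto
  then have "allocations w \<subseteq> load w ` ({..<length w} \<rightarrow>\<^sub>E (UNIV :: 'n set))"
    unfolding allocations_def by blast
  then show ?thesis
    by (rule finite_subset) (intro finite_imageI finite_PiE, auto)
qed

lemma allocations_nonempty: "allocations w \<noteq> {}"
  by (simp add: allocations_def)

definition profiles :: "('n::finite \<Rightarrow> real set) \<Rightarrow> ('n \<Rightarrow> real) set" where
  "profiles \<Theta> = Pi UNIV \<Theta>"

definition algorithm ::
  "real list \<Rightarrow> ('n::finite \<Rightarrow> real set) \<Rightarrow> (('n \<Rightarrow> real) \<Rightarrow> ('n \<Rightarrow> real)) \<Rightarrow> bool" where
  "algorithm w \<Theta> A \<longleftrightarrow> (\<forall>\<theta>\<in>profiles \<Theta>. A \<theta> \<in> allocations w)"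

definition approximates ::
  "real list \<Rightarrow> ('n::finite \<Rightarrow> real set) \<Rightarrow> real \<Rightarrow> (('n \<Rightarrow> real) \<Rightarrow> ('n \<Rightarrow> real)) \<Rightarrow> bool" where
  "approximates w \<Theta> \<alpha> A \<longleftrightarrow>
     (\<forall>\<theta>\<in>profiles \<Theta>. makespan \<theta> (A \<theta>) \<le> \<alpha> * min_makespan w \<theta>)"

text \<open>The utility of agent \<open>i\<close> with true type \<open>t\<close> when the reported profile is \<open>\<theta>\<close>.\<close>

definition utility ::
  "(('n::finite \<Rightarrow> real) \<Rightarrow> ('n \<Rightarrow> real)) \<Rightarrow> (('n \<Rightarrow> real) \<Rightarrow> ('n \<Rightarrow> real)) \<Rightarrow>
   'n \<Rightarrow> real \<Rightarrow> ('n \<Rightarrow> real) \<Rightarrow> real" where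
  "utility A p i t \<theta> = p \<theta> i - A \<theta> i * t"

text \<open>
  Only agent \<open>i\<close> misreports; the utilities of both \<open>i\<close> and \<open>j\<close> are evaluated at their true types
  in \<open>\<theta>\<close>.
\<close>

definition bribeproof ::
  "('n::finite \<Rightarrow> real set) \<Rightarrow> (('n \<Rightarrow> real) \<Rightarrow> ('n \<Rightarrow> real)) \<Rightarrow>
   (('n \<Rightarrow> real) \<Rightarrow> ('n \<Rightarrow> real)) \<Rightarrow> bool" where
  "bribeproof \<Theta> A p \<longleftrightarrow>
     (\<forall>\<theta>\<in>profiles \<Theta>. \<forall>i j. \<forall>t\<in>\<Theta> i.
        (i \<noteq> j \<longrightarrow>
           utility A p i (\<theta> i) \<theta> + utility A p j (\<theta> j) \<theta>
             \<ge> utility A p i (\<theta> i) (\<theta>(i := t)) + utility A p j (\<theta> j) (\<theta>(i := t))) \<and>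
        (i = j \<longrightarrow> utility A p i (\<theta> i) \<theta> \<ge> utility A p i (\<theta> i) (\<theta>(i := t))))"

definition linear_payment ::
  "real \<Rightarrow> real \<Rightarrow> real \<Rightarrow> ('n::finite \<Rightarrow> real) \<Rightarrow> (('n \<Rightarrow> real) \<Rightarrow> ('n \<Rightarrow> real)) \<Rightarrow>
   ('n \<Rightarrow> real) \<Rightarrow> ('n \<Rightarrow> real)" where
  "linear_payment L H l f A \<theta> i = A \<theta> i * (l * L + (1 - l) * H) + f i"

end

theory Submission
  imports Defs
begin

text \<open>
  Take jobs of sizes \<open>3, 3, 1\<close> and \<open>L = 1\<close>, \<open>H = 2 \<surd>3\<close>. With a single agent of type \<open>H\<close>, an
  allocation within a factor below \<open>2 / \<surd>3\<close> must give loads \<open>3, 3\<close> to the \<open>L\<close>-agents and \<open>1\<close> to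
  the \<open>H\<close>-agent. With two \<open>H\<close>-agents, no \<open>H\<close>-agent can receive a job of size \<open>3\<close>. When an agent
  of type \<open>L\<close> switches to \<open>H\<close> while the other two have different types, bribeproofness does not
  let the load of the other \<open>H\<close>-agent decrease. Reaching a profile with two \<open>H\<close>-agents from both
  profiles in which one of them has type \<open>L\<close>, each of the two has load at least \<open>1\<close>; but there
  is only one job of size \<open>1\<close>.
\<close>

lemma sum_load:
  fixes s :: "nat \<Rightarrow> 'n::finite"
  shows "(\<Sum>i\<in>UNIV. load w s i) = sum_list w"
proof -
  have "(\<Sum>i\<in>UNIV. load w s i) = (\<Sum>i\<in>UNIV. \<Sum>m | m \<in> {..<length w} \<and> s m = i. w ! m)"
    by (simp add: load_def)
  also have "\<dots> = (\<Sum>m<length w. w ! m)"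
    by (rule sum.group) auto
  finally show ?thesis
    by (simp add: sum_list_sum_nth atLeast0LessThan)
qed

lemma load_nonneg:
  assumes "\<And>x. x \<in> set w \<Longrightarrow> 0 \<le> x"
  shows "0 \<le> load w s i"
  unfolding load_def by (intro sum_nonneg) (auto intro: assms)

lemma makespan_ge: "a i * \<theta> i \<le> makespan \<theta> a"
  unfolding makespan_def by (intro Max_ge) auto

lemma makespan_le_iff: "makespan \<theta> a \<le> M \<longleftrightarrow> (\<forall>i. a i * \<theta> i \<le> M)"
  unfolding makespan_def by (subst Max_le_iff) auto

lemma min_makespan_le: "min_makespan w \<theta> \<le> makespan \<theta> (load w s)"
  unfolding min_makespan_def
  by (intro Min_le finite_imageI finite_allocations) (auto simp: allocations_def)

lemma min_makespan_nonneg: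
  assumes "\<And>x. x \<in> set w \<Longrightarrow> 0 \<le> x" "\<And>i. 0 \<le> \<theta> i"
  shows "0 \<le> min_makespan w \<theta>"
proof -
  have "min_makespan w \<theta> \<in> makespan \<theta> ` allocations w"
    unfolding min_makespan_def
    by (intro Min_in finite_imageI finite_allocations) (simp add: allocations_nonempty)
  then obtain s where s: "min_makespan w \<theta> = makespan \<theta> (load w s)"
    by (auto simp: allocations_def)
  have "0 \<le> load w s undefined * \<theta> undefined"
    by (intro mult_nonneg_nonneg load_nonneg assms)
  also have "\<dots> \<le> makespan \<theta> (load w s)"
    by (rule makespan_ge)
  finally show ?thesis
    by (simp add: s)
qed

text \<open>The solution \<open>s\<close> witnesses that the optimum is at most \<open>M\<close>.
  Strictness comes from \<alpha> < \<beta> when the optimum is positive, and from 0 < \<beta> * M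
  when it is zero.\<close>

lemma approximates_less:
  assumes "approximates w \<Theta> \<alpha> A" "\<theta> \<in> profiles \<Theta>" "\<alpha> < \<beta>" "0 < \<beta>"
    and "\<And>x. x \<in> set w \<Longrightarrow> 0 \<le> x" "\<And>i. 0 \<le> \<theta> i"
    and "0 < M" "\<And>i. load w s i * \<theta> i \<le> M"
  shows "A \<theta> i * \<theta> i < \<beta> * M"
proof -
  let ?m = "min_makespan w \<theta>"
  have m: "0 \<le> ?m"
    by (rule min_makespan_nonneg) (fact assms)+
  have "makespan \<theta> (load w s) \<le> M"
    by (simp add: makespan_le_iff assms)
  then have "?m \<le> M"
    using min_makespan_le[of w \<theta> s] by linarith
  have "A \<theta> i * \<theta> i \<le> \<alpha> * ?m"
    using assms(1,2) makespan_ge[of "A \<theta>" i \<theta>] unfolding approximates_def by fastforce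
  also have "\<alpha> * ?m < \<beta> * M"
  proof (cases "?m = 0")
    case True
    then show ?thesis using assms by simp
  next
    case False
    then have "\<alpha> * ?m < \<beta> * ?m"
      using m assms by simp
    also have "\<dots> \<le> \<beta> * M"
      using \<open>?m \<le> M\<close> assms by simp
    finally show ?thesis .
  qed
  finally show ?thesis .
qed

lemma bribeproof_linear_load_mono:
  fixes A :: "('n::finite \<Rightarrow> real) \<Rightarrow> ('n \<Rightarrow> real)"
  assumes "algorithm w (\<lambda>_. {L, H}) A"
    and "bribeproof (\<lambda>_. {L, H}) A (linear_payment L H l f A)"
    and "l \<le> 1" "L < H"
    and ijk: "i \<noteq> j" "i \<noteq> k" "j \<noteq> k" "UNIV = {i, j, k}"
    and \<theta>: "\<theta> i = L" "\<theta> j = L" "\<theta> k = H"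
  shows "A \<theta> k \<le> A (\<theta>(i := H)) k"
proof -
  define \<theta>' where "\<theta>' = \<theta>(i := H)"
  have "\<theta> m \<in> {L, H}" for m
    using \<theta> ijk(4) by (metis UNIV_I insertE insertCI singletonD)
  then have prof: "\<theta> \<in> profiles (\<lambda>_. {L, H})" "\<theta>' \<in> profiles (\<lambda>_. {L, H})"
    by (auto simp: profiles_def \<theta>'_def Pi_iff)
  then have "A \<theta> \<in> allocations w" "A \<theta>' \<in> allocations w"
    using assms(1) by (auto simp: algorithm_def)
  then have "sum (A \<theta>) UNIV = sum (A \<theta>') UNIV"
    by (auto simp: allocations_def sum_load)
  then have total: "A \<theta> i + A \<theta> j + A \<theta> k = A \<theta>' i + A \<theta>' j + A \<theta>' k"
    unfolding ijk(4) using ijk(1-3) by (simp add: add.assoc)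
  have bp: "utility A p i L \<theta>' + utility A p m (\<theta> m) \<theta>' \<le> utility A p i L \<theta> + utility A p m (\<theta> m) \<theta>"
    if "m \<noteq> i" "p = linear_payment L H l f A" for m p
    using assms(2) prof(1) that \<theta>(1) unfolding bribeproof_def \<theta>'_def
    by (metis insertI1 insertI2)
  \<comment> \<open>Per unit of load, an agent of type \<open>L\<close> gains
    \<open>(1 - l) * (H - L)\<close> and an agent of type \<open>H\<close> loses
    \<open>l * (H - L)\<close>; the constants \<open>f\<close> cancel.\<close>
  have ij: "(1 - l) * (H - L) * (A \<theta>' i + A \<theta>' j) \<le> (1 - l) * (H - L) * (A \<theta> i + A \<theta> j)"
    using bp[of j] ijk \<theta> by (simp add: utility_def linear_payment_def algebra_simps)
  have ik: "(1 - l) * (H - L) * A \<theta>' i - l * (H - L) * A \<theta>' k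
      \<le> (1 - l) * (H - L) * A \<theta> i - l * (H - L) * A \<theta> k"
    using bp[of k] ijk \<theta> by (simp add: utility_def linear_payment_def algebra_simps)
  show ?thesis
  \<comment> \<open>For \<open>l < 1\<close>, the joint load of \<open>i\<close> and
    \<open>j\<close> cannot grow, and the total is fixed, so \<open>k\<close> cannot lose load. For
    \<open>l = 1\<close> the pair \<open>i\<close>, \<open>j\<close> is indifferent, but then the
    joint utility of \<open>i\<close> and \<open>k\<close> depends only on the load of
    \<open>k\<close>.\<close>
  proof (cases "l = 1")
    case True
    then show ?thesis
      using ik \<open>L < H\<close> by (simp add: \<theta>'_def)
  next
    case False
    then have "0 < (1 - l) * (H - L)"
      using assms by simp
    then have "A \<theta>' i + A \<theta>' j \<le> A \<theta> i + A \<theta> j"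
      using ij by (simp only: mult_le_cancel_left_pos)
    then show ?thesis
      using total by (simp add: \<theta>'_def)
  qed
qed

lemma load_331:
  "load [3, 3, 1] s i = (if s 0 = i then 3 else 0) + (if s 1 = i then 3 else 0) + (if s 2 = i then 1 else 0)"
proof -
  have "load [3, 3, 1] s i = (\<Sum>m | m \<in> {0, 1, 2} \<and> s m = i. [3, 3, 1] ! m)"
    unfolding load_def by (intro sum.cong) auto
  also have "\<dots> = (\<Sum>m\<in>{0, 1, 2}. if s m = i then [3, 3, 1] ! m else 0)"
    by (subst sum.inter_filter) auto
  finally show ?thesis
    by simp
qed

theorem theorem25:
  fixes \<alpha> :: real
  assumes "\<alpha> < 2 / sqrt 3"
  shows "\<exists>(w :: real list) (L :: real) (H :: real).
           (\<forall>x\<in>set w. 0 < x) \<and> 0 < L \<and> L < H \<and>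
           \<not> (\<exists>l\<in>{0..1}. \<exists>(A :: (3 \<Rightarrow> real) \<Rightarrow> (3 \<Rightarrow> real)) (f :: 3 \<Rightarrow> real).
                algorithm w (\<lambda>_. {L, H}) A \<and>
                approximates w (\<lambda>_. {L, H}) \<alpha> A \<and>
                bribeproof (\<lambda>_. {L, H}) A (linear_payment L H l f A))"
proof -
  \<comment> \<open>This \<open>H\<close> solves \<open>4 / H = 2 / sqrt 3\<close>, where 4 is the
    least load above 3 that can be formed from the jobs.\<close>
  define H :: real where "H = 2 * sqrt 3"
  define w :: "real list" where "w = [3, 3, 1]"
  let ?\<Theta> = "\<lambda>_ :: 3. {1, H}"
  have bound4: "2 / sqrt 3 * H = 4" and bound12: "2 / sqrt 3 * 6 = 2 * H"
    using real_div_sqrt[of 3] by (auto simp: H_def field_simps)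
  have "3 \<le> H"
    unfolding H_def using real_le_rsqrt[of "3/2" 3] by (simp add: power2_eq_square)
  then have "1 < H"
    by simp
  have "H \<le> 6"
    unfolding H_def using real_le_lsqrt[of 3 3] by simp
  have no_mechanism: False
    if A: "algorithm w ?\<Theta> A" "approximates w ?\<Theta> \<alpha> A"
      and bp: "bribeproof ?\<Theta> A (linear_payment 1 H l f A)" and l: "l \<le> 1"
    for l :: real and A and f :: "3 \<Rightarrow> real"
  proof -
    have alloc: "\<exists>s. A \<theta> = load w s" if "\<theta> \<in> profiles ?\<Theta>" for \<theta>
      using A(1) that by (auto simp: algorithm_def allocations_def)
    have bound: "A \<theta> m * \<theta> m < 2 / sqrt 3 * M"
      if "\<theta> \<in> profiles ?\<Theta>" "0 < M" "\<And>i. load w s i * \<theta> i \<le> M" for \<theta> m M s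
    proof (rule approximates_less[OF A(2) that(1) assms])
      show "0 \<le> \<theta> i" for i
        using that(1) \<open>1 < H\<close> by (force simp: profiles_def Pi_iff)
    qed (use that in \<open>auto simp: w_def\<close>)
    define \<tau> :: "3 \<Rightarrow> real" where "\<tau> = (\<lambda>m. if m = 1 then 1 else H)"
    have \<tau>: "\<tau> \<in> profiles ?\<Theta>"
      by (auto simp: profiles_def \<tau>_def)
    have ge: "1 \<le> A \<tau> k" if ijk: "i \<noteq> 1" "k \<noteq> 1" "i \<noteq> k" "UNIV = {i, 1, k}" for i k :: 3
    proof -
      define \<theta> where "\<theta> = \<tau>(i := 1)"
      have \<theta>: "\<theta> i = 1" "\<theta> 1 = 1" "\<theta> k = H" and \<tau>_eq: "\<tau> = \<theta>(i := H)"
        using ijk by (auto simp: \<theta>_def \<tau>_def)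
      have prof: "\<theta> \<in> profiles ?\<Theta>"
        by (auto simp: profiles_def \<tau>_def \<theta>_def)
      \<comment> \<open>Loads 3, 3, 1 have makespan \<open>H\<close>, since
        \<open>3 \<le> H\<close>.\<close>
      define s :: "nat \<Rightarrow> 3" where "s = (\<lambda>m. if m = 0 then i else if m = 1 then 1 else k)"
      have s: "load w s m * \<theta> m \<le> H" for m
      proof -
        have "m \<in> {i, 1, k}" using ijk(4) by blast
        then show ?thesis
          using \<theta> ijk(1-3) \<open>3 \<le> H\<close> by (auto simp: w_def load_331 s_def)
      qed
      obtain s' where s': "A \<theta> = load w s'"
        using alloc[OF prof] by blast
      have "A \<theta> i < 4" "A \<theta> 1 < 4"
        using bound[OF prof _ s, of i] bound[OF prof _ s, of 1] \<open>1 < H\<close> \<theta>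
        unfolding bound4 by auto
      moreover have "s' m = i \<or> s' m = 1 \<or> s' m = k" for m
        using ijk(4) by blast
      then have "s' 0 = i \<or> s' 0 = 1 \<or> s' 0 = k" "s' 1 = i \<or> s' 1 = 1 \<or> s' 1 = k"
        "s' 2 = i \<or> s' 2 = 1 \<or> s' 2 = k"
        by simp_all
      \<comment> \<open>If \<open>k\<close> had no job, the total 7 would be split between
        \<open>i\<close> and agent 1, and one of them would have load at least 4.\<close>
      ultimately have "1 \<le> A \<theta> k"
        using ijk(1-3) by (elim disjE) (simp_all add: s' w_def load_331)
      also have "A \<theta> k \<le> A \<tau> k"
        unfolding \<tau>_eq
        by (rule bribeproof_linear_load_mono[OF A(1) bp l \<open>1 < H\<close> _ _ _ _ \<theta>]) (use ijk in auto)
      finally show ?thesis .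
    qed
    have "1 \<le> A \<tau> 2" "1 \<le> A \<tau> 3"
      using ge[of 3 2] ge[of 2 3] UNIV_3 by auto
    moreover have "A \<tau> 2 < 2" "A \<tau> 3 < 2"
    proof -
      \<comment> \<open>Loads 6, 1, 0 have makespan 6, since \<open>H \<le> 6\<close>. The resulting
        bound 2 separates load 1 from load 3.\<close>
      define s :: "nat \<Rightarrow> 3" where "s = (\<lambda>m. if m = 2 then 2 else 1)"
      have "load w s m * \<tau> m \<le> 6" for m
        using \<open>H \<le> 6\<close> by (auto simp: w_def load_331 s_def \<tau>_def)
      from bound[OF \<tau> _ this, of 2] bound[OF \<tau> _ this, of 3]
      have "A \<tau> 2 * H < 2 * H" "A \<tau> 3 * H < 2 * H"
        unfolding bound12 by (simp_all add: \<tau>_def)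
      then show "A \<tau> 2 < 2" "A \<tau> 3 < 2"
        using \<open>1 < H\<close> by simp_all
    qed
    \<comment> \<open>A load in [1, 2) consists of the job of size 1 alone, which agents 2 and 3
      cannot both have.\<close>
    ultimately show False
      using alloc[OF \<tau>] by (auto simp: w_def load_331 split: if_splits)
  qed
  show ?thesis
    by (rule exI[of _ w], rule exI[of _ 1], rule exI[of _ H])
      (use \<open>1 < H\<close> no_mechanism in \<open>auto simp: w_def\<close>)
qed

end
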